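(* Let $n,m$ be positive integers and let $v=(v_p)_{p\in\mathbb{R}^m}\in\mathcal{S}(\mathbb{R}^m,\mathcal{S}_n')$ be a Schwartz family of tempered distributions. Then $v$ is summable with respect to every distribution in $\mathcal{S}_m'$; in other terms, for every tempered distribution $a\in\mathcal{S}_m'$, the composition $u=a\circ\widehat{v}$, i.e. the linear functional $$u:\mathcal{S}_n\to\mathbb{K},\qquad \phi\mapsto a(\widehat{v}(\phi)),$$ is a tempered distribution in the space $\mathcal{S}_n'$.
   Context: $\mathbb{K}$ denotes $\mathbb{R}$ or $\mathbb{C}$. $\mathcal{S}_n$ is the Schwartz space of $\mathbb{K}$-valued rapidly decreasing smooth functions on $\mathbb{R}^n$ with its natural Fréchet topology, and $\mathcal{S}_n'$ is its topological dual, the space of tempered distributions on $\mathbb{R}^n$. A family of tempered distributions indexed by $\mathbb{R}^m$ is a map $v:\mathbb{R}^m\to\mathcal{S}_n'$, $p\mapsto v_p$. For $\phi\in\mathcal{S}_n$, its image under $v$ is the function $v(\phi):\mathbb{R}^m\to\mathbb{K}$, $v(\phi)(p):=v_p(\phi)$. The family $v$ is called a Schwartz family (or $^{\mathcal{S}}$family) if $v(\phi)\in\mathcal{S}_m$ for every $\phi\in\mathcal{S}_n$ (no continuity of $\phi\mapsto v(\phi)$ is assumed). The set of all Schwartz families indexed by $\mathbb{R}^m$ in $\mathcal{S}_n'$ is denoted $\mathcal{S}(\mathbb{R}^m,\mathcal{S}_n')$. The operator generated by a Schwartz family $v$ is the linear map $\widehat{v}:\mathcal{S}_n\to\mathcal{S}_m$,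 $\phi\mapsto v(\phi)$. A Schwartz family $v$ is summable with respect to a linear functional $a$ on $\mathcal{S}_m$ if the linear functional $a\circ\widehat{v}$ on $\mathcal{S}_n$ belongs to $\mathcal{S}_n'$. *)

theory Defs
  imports "HOL-Analysis.Analysis"
begin

definition partial_deriv :: "'n::finite \<Rightarrow> (real ^ 'n \<Rightarrow> 'k::real_normed_field) \<Rightarrow> real ^ 'n \<Rightarrow> 'k"
  where "partial_deriv i f x = frechet_derivative f (at x) (axis i 1)"

text \<open>Iterated partial derivatives are indexed by words in the coordinate indices rather than by
  multi-indices; on smooth functions the order of the letters is irrelevant, so both indexings yield
  the same derivatives. A function is smooth iff all its iterated partial derivatives are
  (Frechet) differentiable.\<close>

primrec iter_partial_deriv ::
    "'n::finite list \<Rightarrow> (real ^ 'n \<Rightarrow> 'k::real_normed_field) \<Rightarrow> real ^ 'n \<Rightarrow> 'k"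
  where
    "iter_partial_deriv [] f = f"
  | "iter_partial_deriv (i # is) f = partial_deriv i (iter_partial_deriv is f)"

definition smooth :: "(real ^ 'n::finite \<Rightarrow> 'k::real_normed_field) \<Rightarrow> bool"
  where "smooth f \<longleftrightarrow> (\<forall>is. iter_partial_deriv is f differentiable_on UNIV)"

definition weighted_deriv ::
    "('n::finite \<Rightarrow> nat) \<Rightarrow> 'n list \<Rightarrow> (real ^ 'n \<Rightarrow> 'k::real_normed_field) \<Rightarrow> real ^ 'n \<Rightarrow> 'k"
  where "weighted_deriv \<alpha> is f x = (\<Prod>i\<in>UNIV. (x $ i) ^ \<alpha> i) *\<^sub>R iter_partial_deriv is f x"

definition schwartz_space :: "(real ^ 'n::finite \<Rightarrow> 'k::real_normed_field) set"
  where "schwartz_space = {f. smooth f \<and> (\<forall>\<alpha> is. bounded (range (weighted_deriv \<alpha> is f)))}"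

definition schwartz_seminorm ::
    "('n::finite \<Rightarrow> nat) \<Rightarrow> 'n list \<Rightarrow> (real ^ 'n \<Rightarrow> 'k::real_normed_field) \<Rightarrow> real"
  where "schwartz_seminorm \<alpha> is f = (SUP x. norm (weighted_deriv \<alpha> is f x))"

definition schwartz_topology :: "(real ^ 'n::finite \<Rightarrow> 'k::real_normed_field) topology"
  where "schwartz_topology = topology_generated_by
    {{g \<in> schwartz_space. schwartz_seminorm \<alpha> is (\<lambda>x. g x - f x) < e} | \<alpha> is f e.
      f \<in> schwartz_space \<and> 0 < e}"

lemma schwartz_seminorm_zero:
  "schwartz_seminorm \<alpha> is (\<lambda>x :: real ^ 'n::finite. 0 :: 'k::real_normed_field) = 0"
proof -
  have "iter_partial_deriv is (\<lambda>x :: real ^ 'n. 0 :: 'k) = (\<lambda>x. 0)"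
    by (induction "is") (auto simp: partial_deriv_def)
  then show ?thesis
    by (simp add: schwartz_seminorm_def weighted_deriv_def)
qed

lemma topspace_schwartz_topology:
  "topspace (schwartz_topology :: (real ^ 'n::finite \<Rightarrow> 'k::real_normed_field) topology) =
    schwartz_space"
proof
  show "topspace schwartz_topology \<subseteq> (schwartz_space :: (real ^ 'n \<Rightarrow> 'k) set)"
    unfolding schwartz_topology_def topology_generated_by_topspace by blast
  show "(schwartz_space :: (real ^ 'n \<Rightarrow> 'k) set) \<subseteq> topspace schwartz_topology"
  proof
    fix f :: "real ^ 'n \<Rightarrow> 'k"
    assume f: "f \<in> schwartz_space"
    let ?B = "{g \<in> schwartz_space. schwartz_seminorm (\<lambda>_. 0) [] (\<lambda>x. g x - f x) < 1}"
    have "f \<in> ?B"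
      using f by (simp add: schwartz_seminorm_zero)
    moreover have "openin schwartz_topology ?B"
      unfolding schwartz_topology_def
      by (rule topology_generated_by_Basis) (use f zero_less_one in blast)
    ultimately show "f \<in> topspace schwartz_topology"
      unfolding topspace_def by blast
  qed
qed

text \<open>Maps on the Schwartz space are represented as functions that are \<^const>\<open>extensional\<close> on
  \<open>schwartz_space\<close>, so that they are determined by their values there.\<close>

definition linear_functional :: "((real ^ 'n::finite \<Rightarrow> 'k::real_normed_field) \<Rightarrow> 'k) \<Rightarrow> bool"
  where "linear_functional a \<longleftrightarrow> a \<in> extensional schwartz_space \<and>
    (\<forall>f\<in>schwartz_space. \<forall>g\<in>schwartz_space. a (\<lambda>x. f x + g x) = a f + a g) \<and>
    (\<forall>c. \<forall>f\<in>schwartz_space. a (\<lambda>x. c * f x) = c * a f)"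

definition tempered_distributions ::
    "((real ^ 'n::finite \<Rightarrow> 'k::real_normed_field) \<Rightarrow> 'k) set"
  where "tempered_distributions =
    {a. linear_functional a \<and> continuous_map schwartz_topology euclidean a}"

definition family_image ::
    "(real ^ 'm::finite \<Rightarrow> (real ^ 'n::finite \<Rightarrow> 'k::real_normed_field) \<Rightarrow> 'k)
      \<Rightarrow> (real ^ 'n \<Rightarrow> 'k) \<Rightarrow> real ^ 'm \<Rightarrow> 'k"
  where "family_image v \<phi> = (\<lambda>p. v p \<phi>)"

definition schwartz_families ::
    "(real ^ 'm::finite \<Rightarrow> (real ^ 'n::finite \<Rightarrow> 'k::real_normed_field) \<Rightarrow> 'k) set"
  where "schwartz_families =
    {v. (\<forall>p. v p \<in> tempered_distributions) \<and>
        (\<forall>\<phi>\<in>schwartz_space. family_image v \<phi> \<in> schwartz_space)}"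

definition generated_operator ::
    "(real ^ 'm::finite \<Rightarrow> (real ^ 'n::finite \<Rightarrow> 'k::real_normed_field) \<Rightarrow> 'k)
      \<Rightarrow> (real ^ 'n \<Rightarrow> 'k) \<Rightarrow> real ^ 'm \<Rightarrow> 'k"
  where "generated_operator v = (\<lambda>\<phi>\<in>schwartz_space. family_image v \<phi>)"

definition summable_wrt ::
    "(real ^ 'm::finite \<Rightarrow> (real ^ 'n::finite \<Rightarrow> 'k::real_normed_field) \<Rightarrow> 'k)
      \<Rightarrow> ((real ^ 'm \<Rightarrow> 'k) \<Rightarrow> 'k) \<Rightarrow> bool"
  where "summable_wrt v a \<longleftrightarrow>
    compose schwartz_space a (generated_operator v) \<in> tempered_distributions"

end

theory Submission
  imports Defs
begin

text \<open>
  The statement amounts to the continuity of the operator \<open>\<phi> \<mapsto> v(\<phi>)\<close> generated by a Schwartz family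
  \<open>v\<close>, which is not assumed. It is automatic because the Schwartz space is complete for countably
  many seminorms, so that the uniform boundedness principle holds on it: a family of continuous
  linear functionals that is bounded at every point is bounded by one and the same multiple of one
  seminorm (\<open>schwartz_uniform_boundedness\<close>).

  This principle is used twice. Every member \<open>v p\<close> is continuous, that is, \<open>\<phi> \<mapsto> v(\<phi>)(p)\<close> is.
  A partial derivative of \<open>v(\<phi>)\<close> at a point is the limit of a sequence of difference quotients,
  and a pointwise limit of continuous functionals is continuous by uniform boundedness; by induction
  on the order of differentiation, \<open>\<phi> \<mapsto> \<partial>\<^sup>\<beta> v(\<phi>)(p)\<close> is continuous for all \<open>\<beta>\<close> and \<open>p\<close>
  (\<open>dominated_iter_partial_deriv_family_image\<close>). Since \<open>v(\<phi>)\<close> is a Schwartz function, for fixed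
  \<open>\<alpha>\<close> and \<open>\<beta>\<close> the functionals \<open>\<phi> \<mapsto> p\<^sup>\<alpha> \<partial>\<^sup>\<beta> v(\<phi>)(p)\<close>, indexed by \<open>p\<close>, are bounded at every \<open>\<phi>\<close>.
  Uniform boundedness now bounds their supremum over \<open>p\<close>, a defining seminorm of \<open>v(\<phi>)\<close>, by a
  seminorm of \<open>\<phi>\<close> (\<open>dominated_schwartz_seminorm_family_image\<close>). This is the continuity of
  \<open>\<phi> \<mapsto> v(\<phi>)\<close>, and composing with \<open>a\<close> preserves it.

  The argument is carried out over an arbitrary complete normed field over the reals, which covers
  both kinds of scalars at once.
\<close>

section \<open>Iterated partial derivatives and the Schwartz seminorms\<close>

lemma partial_deriv_eqI:
  assumes "(f has_derivative f') (at x)"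
  shows "partial_deriv i f x = f' (axis i 1)"
  using frechet_derivative_at[OF assms] by (simp add: partial_deriv_def)

lemma has_derivative_partial_derivs:
  fixes f :: "real ^ 'n::finite \<Rightarrow> 'k::real_normed_field"
  assumes "f differentiable (at x)"
  shows "(f has_derivative (\<lambda>h. \<Sum>i\<in>UNIV. (h $ i) *\<^sub>R partial_deriv i f x)) (at x)"
proof -
  let ?D = "frechet_derivative f (at x)"
  have D: "(f has_derivative ?D) (at x)"
    using assms by (simp add: frechet_derivative_works)
  then interpret D: bounded_linear ?D
    by (rule has_derivative_bounded_linear)
  have "?D h = (\<Sum>i\<in>UNIV. (h $ i) *\<^sub>R partial_deriv i f x)" for h
  proof -
    have "?D h = ?D (\<Sum>i\<in>UNIV. (h $ i) *\<^sub>R axis i 1)"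
      using basis_expansion[of h] by (simp add: scalar_mult_eq_scaleR)
    also have "\<dots> = (\<Sum>i\<in>UNIV. (h $ i) *\<^sub>R partial_deriv i f x)"
      by (simp add: D.sum D.scaleR partial_deriv_def)
    finally show ?thesis .
  qed
  then have "?D = (\<lambda>h. \<Sum>i\<in>UNIV. (h $ i) *\<^sub>R partial_deriv i f x)" by blast
  with D show ?thesis by simp
qed

lemma smoothD: "smooth f \<Longrightarrow> iter_partial_deriv is f differentiable (at x)"
  by (simp add: smooth_def differentiable_on_def)

lemma iter_partial_deriv_add:
  assumes "smooth f" "smooth g"
  shows "iter_partial_deriv is (\<lambda>x. f x + g x) =
    (\<lambda>x. iter_partial_deriv is f x + iter_partial_deriv is g x)"
proof (induction "is")
  case (Cons i "is")
  have "partial_deriv i (\<lambda>x. iter_partial_deriv is f x + iter_partial_deriv is g x) x =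
      partial_deriv i (iter_partial_deriv is f) x + partial_deriv i (iter_partial_deriv is g) x" for x
  proof -
    have "((\<lambda>x. iter_partial_deriv is f x + iter_partial_deriv is g x) has_derivative
       (\<lambda>h. frechet_derivative (iter_partial_deriv is f) (at x) h
          + frechet_derivative (iter_partial_deriv is g) (at x) h)) (at x)"
      using smoothD[OF assms(1)] smoothD[OF assms(2)]
      by (intro has_derivative_add) (simp_all add: frechet_derivative_works)
    from partial_deriv_eqI[OF this] show ?thesis by (simp add: partial_deriv_def)
  qed
  then show ?case by (simp add: Cons.IH fun_eq_iff)
qed simp

lemma iter_partial_deriv_cmult:
  assumes "smooth f"
  shows "iter_partial_deriv is (\<lambda>x. c * f x) = (\<lambda>x. c * iter_partial_deriv is f x)"
proof (induction "is")
  case (Cons i "is")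
  have "partial_deriv i (\<lambda>x. c * iter_partial_deriv is f x) x =
      c * partial_deriv i (iter_partial_deriv is f) x" for x
  proof -
    have "((\<lambda>x. c * iter_partial_deriv is f x) has_derivative
       (\<lambda>h. c * frechet_derivative (iter_partial_deriv is f) (at x) h)) (at x)"
      using smoothD[OF assms]
      by (intro has_derivative_mult_right) (simp_all add: frechet_derivative_works)
    from partial_deriv_eqI[OF this] show ?thesis by (simp add: partial_deriv_def)
  qed
  then show ?case by (simp add: Cons.IH fun_eq_iff)
qed simp

lemma smooth_add: "smooth f \<Longrightarrow> smooth g \<Longrightarrow> smooth (\<lambda>x. f x + g x)"
  by (simp add: iter_partial_deriv_add smooth_def differentiable_on_add)

lemma smooth_cmult: 
  assumes "smooth f"
  shows "smooth (\<lambda>x. c * f x)"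
  unfolding smooth_def iter_partial_deriv_cmult[OF assms]
  using assms by (simp add: smooth_def differentiable_on_mult)

lemma weighted_deriv_add:
  "smooth f \<Longrightarrow> smooth g \<Longrightarrow>
    weighted_deriv \<alpha> is (\<lambda>x. f x + g x) x = weighted_deriv \<alpha> is f x + weighted_deriv \<alpha> is g x"
  by (simp add: weighted_deriv_def iter_partial_deriv_add scaleR_add_right)

lemma weighted_deriv_cmult:
  "smooth f \<Longrightarrow> weighted_deriv \<alpha> is (\<lambda>x. c * f x) x = c * weighted_deriv \<alpha> is f x"
  by (simp add: weighted_deriv_def iter_partial_deriv_cmult)

lemma schwartz_smooth: "f \<in> schwartz_space \<Longrightarrow> smooth f"
  by (simp add: schwartz_space_def)

lemma norm_weighted_deriv_le:
  assumes "f \<in> schwartz_space"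
  shows "norm (weighted_deriv \<alpha> is f x) \<le> schwartz_seminorm \<alpha> is f"
proof -
  have "bounded (range (weighted_deriv \<alpha> is f))"
    using assms by (simp add: schwartz_space_def)
  then have "bdd_above (range (\<lambda>x. norm (weighted_deriv \<alpha> is f x)))"
    by (auto simp: bounded_iff bdd_above_def)
  then show ?thesis
    unfolding schwartz_seminorm_def by (rule cSUP_upper[OF UNIV_I])
qed

lemma schwartz_seminorm_least:
  assumes "\<And>x. norm (weighted_deriv \<alpha> is f x) \<le> B"
  shows "schwartz_seminorm \<alpha> is f \<le> B"
  unfolding schwartz_seminorm_def by (rule cSUP_least) (simp_all add: assms)

lemma schwartz_spaceI:
  assumes "smooth f" "\<And>\<alpha> is. \<exists>B. \<forall>x. norm (weighted_deriv \<alpha> is f x) \<le> B"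
  shows "f \<in> schwartz_space"
  using assms by (simp add: schwartz_space_def bounded_iff)

lemma norm_iter_partial_deriv_le:
  assumes "f \<in> schwartz_space"
  shows "norm (iter_partial_deriv is f x) \<le> schwartz_seminorm (\<lambda>_. 0) is f"
  using norm_weighted_deriv_le[OF assms, of "\<lambda>_. 0" "is" x] by (simp add: weighted_deriv_def)

lemma schwartz_seminorm_nonneg:
  "f \<in> schwartz_space \<Longrightarrow> 0 \<le> schwartz_seminorm \<alpha> is f"
  using norm_weighted_deriv_le[of f \<alpha> "is" 0] norm_ge_zero order_trans by blast

lemma schwartz_add:
  assumes f: "f \<in> schwartz_space" and g: "g \<in> schwartz_space"
  shows "(\<lambda>x. f x + g x) \<in> schwartz_space"
    and "schwartz_seminorm \<alpha> is (\<lambda>x. f x + g x) \<le> schwartz_seminorm \<alpha> is f + schwartz_seminorm \<alpha> is g"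
proof -
  have *: "norm (weighted_deriv \<alpha> is (\<lambda>x. f x + g x) x) \<le> schwartz_seminorm \<alpha> is f + schwartz_seminorm \<alpha> is g"
    for \<alpha> "is" x
    using norm_weighted_deriv_le[OF f, of \<alpha> "is" x] norm_weighted_deriv_le[OF g, of \<alpha> "is" x]
    by (simp add: weighted_deriv_add schwartz_smooth f g norm_triangle_le)
  show "(\<lambda>x. f x + g x) \<in> schwartz_space"
    using * smooth_add[OF f[THEN schwartz_smooth] g[THEN schwartz_smooth]]
    by (intro schwartz_spaceI) blast+
  show "schwartz_seminorm \<alpha> is (\<lambda>x. f x + g x) \<le> schwartz_seminorm \<alpha> is f + schwartz_seminorm \<alpha> is g"
    by (rule schwartz_seminorm_least) (rule *)
qed

lemma schwartz_cmult:
  assumes f: "f \<in> schwartz_space"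
  shows "(\<lambda>x. c * f x) \<in> schwartz_space"
    and "schwartz_seminorm \<alpha> is (\<lambda>x. c * f x) \<le> norm c * schwartz_seminorm \<alpha> is f"
proof -
  have *: "norm (weighted_deriv \<alpha> is (\<lambda>x. c * f x) x) \<le> norm c * schwartz_seminorm \<alpha> is f"
    for \<alpha> "is" x
    using norm_weighted_deriv_le[OF f, of \<alpha> "is" x]
    by (simp add: weighted_deriv_cmult schwartz_smooth f norm_mult mult_left_mono)
  show "(\<lambda>x. c * f x) \<in> schwartz_space"
    using * smooth_cmult[OF f[THEN schwartz_smooth]] by (intro schwartz_spaceI) blast+
  show "schwartz_seminorm \<alpha> is (\<lambda>x. c * f x) \<le> norm c * schwartz_seminorm \<alpha> is f"
    by (rule schwartz_seminorm_least) (rule *)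
qed

lemma schwartz_diff:
  assumes "f \<in> schwartz_space" "g \<in> schwartz_space"
  shows "(\<lambda>x. f x - g x) \<in> schwartz_space"
  using schwartz_add(1)[OF assms(1) schwartz_cmult(1)[OF assms(2), of "-1"]] by simp

lemma schwartz_zero: "(\<lambda>x. 0 :: 'k::real_normed_field) \<in> (schwartz_space :: (real ^ 'n::finite \<Rightarrow> 'k) set)"
proof -
  have eq: "iter_partial_deriv is (\<lambda>x :: real ^ 'n. 0 :: 'k) = (\<lambda>x. 0)"
    for "is" :: "'n list"
    by (induction "is") (auto simp: partial_deriv_def)
  show ?thesis
    by (rule schwartz_spaceI) (auto simp: smooth_def eq weighted_deriv_def)
qed

text \<open>The pairs \<open>(\<alpha>, is)\<close> form a countable type. The sums over the initial segments of an enumeration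
  are an increasing sequence of seminorms that defines the same topology, so that a single number
  replaces a finite set of pairs.\<close>

abbreviation nth_seminorm :: "nat \<Rightarrow> (real ^ 'n::finite \<Rightarrow> 'k::real_normed_field) \<Rightarrow> real"
  where "nth_seminorm k \<equiv> (case from_nat k of (\<alpha>, is) \<Rightarrow> schwartz_seminorm \<alpha> is)"

definition graded_seminorm :: "nat \<Rightarrow> (real ^ 'n::finite \<Rightarrow> 'k::real_normed_field) \<Rightarrow> real"
  where "graded_seminorm N f = (\<Sum>k<N. nth_seminorm k f)"

lemma graded_seminorm_nonneg: "f \<in> schwartz_space \<Longrightarrow> 0 \<le> graded_seminorm N f"
  by (simp add: graded_seminorm_def sum_nonneg schwartz_seminorm_nonneg case_prod_beta)

lemma graded_seminorm_mono:
  "f \<in> schwartz_space \<Longrightarrow> M \<le> N \<Longrightarrow> graded_seminorm M f \<le> graded_seminorm N f"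
  unfolding graded_seminorm_def by (rule sum_mono2) (auto simp: schwartz_seminorm_nonneg split: prod.split)

lemma graded_seminorm_cmult:
  "f \<in> schwartz_space \<Longrightarrow> graded_seminorm N (\<lambda>x. c * f x) \<le> norm c * graded_seminorm N f"
  by (simp add: graded_seminorm_def sum_distrib_left sum_mono schwartz_cmult(2) case_prod_beta)

lemma schwartz_seminorm_le_graded:
  "\<exists>N. \<forall>f\<in>schwartz_space. schwartz_seminorm \<alpha> is f \<le> graded_seminorm N f"
proof (intro exI ballI)
  fix f :: "real ^ 'a \<Rightarrow> 'b" assume f: "f \<in> schwartz_space"
  let ?k = "to_nat (\<alpha>, is)"
  let ?q = "\<lambda>k. nth_seminorm k f"
  have "?q ?k \<le> (\<Sum>k<Suc ?k. ?q k)"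
    by (rule member_le_sum) (auto simp: schwartz_seminorm_nonneg f split: prod.split)
  then show "schwartz_seminorm \<alpha> is f \<le> graded_seminorm (Suc ?k) f"
    by (simp add: graded_seminorm_def)
qed

section \<open>Completeness of the Schwartz space\<close>

text \<open>Absolute convergence in every seminorm suffices for convergence in the Schwartz space. The bound
  on the seminorms of the sum is as important as membership: applied to the tails, it says
  that the partial sums converge in the topology.\<close>

context
  fixes y :: "nat \<Rightarrow> real ^ 'n::finite \<Rightarrow> 'k::{real_normed_field, banach}"
  assumes y: "\<And>j. y j \<in> schwartz_space"
    and sm: "\<And>\<alpha> is. summable (\<lambda>j. schwartz_seminorm \<alpha> is (y j))"
begin

lemma summable_iter_partial_deriv: "summable (\<lambda>j. iter_partial_deriv is (y j) x)"
  by (rule summable_comparison_test'[OF sm[of "\<lambda>_. 0" "is"]])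
    (rule norm_iter_partial_deriv_le[OF y])

text \<open>The tails of the series of unweighted seminorms bound the tails of the differentiated series
  uniformly in the point, as term-by-term differentiation requires.\<close>

lemma has_derivative_series_iter_partial_deriv:
  "((\<lambda>x. \<Sum>j. iter_partial_deriv is (y j) x) has_derivative
    (\<lambda>h. \<Sum>i\<in>UNIV. (h $ i) *\<^sub>R (\<Sum>j. iter_partial_deriv (i # is) (y j) x))) (at x)"
proof -
  let ?f = "\<lambda>j. iter_partial_deriv is (y j)"
  let ?f' = "\<lambda>j x h. \<Sum>i\<in>UNIV. (h $ i) *\<^sub>R iter_partial_deriv (i # is) (y j) x"
  let ?g' = "\<lambda>x h. \<Sum>i\<in>UNIV. (h $ i) *\<^sub>R (\<Sum>j. iter_partial_deriv (i # is) (y j) x)"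
  define tail where "tail n = (\<Sum>i\<in>UNIV. \<Sum>j. schwartz_seminorm (\<lambda>_. 0) (i # is) (y (j + n)))" for n
  have tail: "tail \<longlonglongrightarrow> 0"
    unfolding tail_def by (rule tendsto_null_sum) (rule suminf_exist_split2[OF sm])
  have bound: "norm ((\<Sum>j<n. ?f' j x h) - ?g' x h) \<le> tail n * norm h" for n x h
  proof -
    have each: "norm ((\<Sum>j<n. iter_partial_deriv (i # is) (y j) x)
        - (\<Sum>j. iter_partial_deriv (i # is) (y j) x))
      \<le> (\<Sum>j. schwartz_seminorm (\<lambda>_. 0) (i # is) (y (j + n)))" (is "norm (?a i - ?b i) \<le> ?t i") for i
    proof -
      have "?b i = (\<Sum>j. iter_partial_deriv (i # is) (y (j + n)) x) + ?a i"
        by (rule suminf_split_initial_segment[OF summable_iter_partial_deriv])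
      then have "norm (?a i - ?b i) = norm (\<Sum>j. iter_partial_deriv (i # is) (y (j + n)) x)"
        by simp
      also have "\<dots> \<le> ?t i"
        by (rule norm_suminf_le[OF norm_iter_partial_deriv_le[OF y]])
          (rule summable_ignore_initial_segment[OF sm])
      finally show ?thesis .
    qed
    have "(\<Sum>j<n. ?f' j x h) - ?g' x h = (\<Sum>i\<in>UNIV. (h $ i) *\<^sub>R (?a i - ?b i))"
      by (subst sum.swap) (simp add: scaleR_sum_right scaleR_diff_right sum_subtractf)
    also have "norm \<dots> \<le> (\<Sum>i\<in>UNIV. norm h * ?t i)"
      by (rule sum_norm_le) (use each component_le_norm_cart[of h] in \<open>auto intro!: mult_mono\<close>)
    also have "\<dots> = tail n * norm h"
      by (simp add: tail_def sum_distrib_left mult.commute)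
    finally show ?thesis .
  qed
  have "\<exists>g. \<forall>x\<in>UNIV. (\<lambda>n. ?f n x) sums (g x) \<and> (g has_derivative ?g' x) (at x within UNIV)"
  proof (rule has_derivative_series)
    show "(?f n has_derivative ?f' n x) (at x within UNIV)" for n x
      using has_derivative_partial_derivs[OF smoothD[OF schwartz_smooth[OF y]]] by simp
    show "\<forall>\<^sub>F n in sequentially. \<forall>x\<in>UNIV. \<forall>h. norm ((\<Sum>i<n. ?f' i x h) - ?g' x h) \<le> e * norm h"
      if "e > 0" for e
    proof -
      have "\<forall>\<^sub>F n in sequentially. tail n < e"
        using order_tendstoD(2)[OF tail that] .
      then show ?thesis
      proof eventually_elim
        case (elim n)
        show ?case
          using bound order_trans mult_right_mono[OF less_imp_le[OF elim] norm_ge_zero] by blast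
      qed
    qed
    show "(\<lambda>n. ?f n 0) sums (\<Sum>n. ?f n 0)"
      by (rule summable_sums[OF summable_iter_partial_deriv])
  qed auto
  then obtain g where g: "\<And>x. (\<lambda>n. ?f n x) sums g x" "\<And>x. (g has_derivative ?g' x) (at x)"
    by auto
  have "g = (\<lambda>x. \<Sum>j. ?f j x)"
    using sums_unique[OF g(1)] by blast
  with g(2) show ?thesis by simp
qed

lemma iter_partial_deriv_series:
  "iter_partial_deriv is (\<lambda>x. \<Sum>j. y j x) = (\<lambda>x. \<Sum>j. iter_partial_deriv is (y j) x)"
proof (induction "is")
  case (Cons i "is")
  have "partial_deriv i (\<lambda>x. \<Sum>j. iter_partial_deriv is (y j) x) x
      = (\<Sum>j. iter_partial_deriv (i # is) (y j) x)" for x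
  proof -
    have "partial_deriv i (\<lambda>x. \<Sum>j. iter_partial_deriv is (y j) x) x =
      (\<Sum>k\<in>UNIV. (axis i 1 $ k) *\<^sub>R (\<Sum>j. iter_partial_deriv (k # is) (y j) x))"
      by (rule partial_deriv_eqI[OF has_derivative_series_iter_partial_deriv])
    also have "\<dots> = (\<Sum>k\<in>UNIV. if k = i then (\<Sum>j. iter_partial_deriv (k # is) (y j) x) else 0)"
      by (rule sum.cong) (auto simp: axis_def)
    finally show ?thesis by simp
  qed
  then show ?case using Cons.IH by auto
qed simp

lemma schwartz_series:
  shows "(\<lambda>x. \<Sum>j. y j x) \<in> schwartz_space"
    and "schwartz_seminorm \<alpha> is (\<lambda>x. \<Sum>j. y j x) \<le> (\<Sum>j. schwartz_seminorm \<alpha> is (y j))"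
proof -
  have *: "norm (weighted_deriv \<alpha> is (\<lambda>x. \<Sum>j. y j x) x) \<le> (\<Sum>j. schwartz_seminorm \<alpha> is (y j))"
    for \<alpha> "is" x
  proof -
    have "weighted_deriv \<alpha> is (\<lambda>x. \<Sum>j. y j x) x = (\<Sum>j. weighted_deriv \<alpha> is (y j) x)"
      by (simp add: weighted_deriv_def iter_partial_deriv_series suminf_scaleR_right
          summable_iter_partial_deriv)
    then show ?thesis
      using norm_suminf_le[OF norm_weighted_deriv_le[OF y] sm] by simp
  qed
  have "smooth (\<lambda>x. \<Sum>j. y j x)"
    unfolding smooth_def iter_partial_deriv_series differentiable_on_def
    using has_derivative_series_iter_partial_deriv differentiable_def by fastforce
  with * show "(\<lambda>x. \<Sum>j. y j x) \<in> schwartz_space"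
    by (intro schwartz_spaceI) auto
  show "schwartz_seminorm \<alpha> is (\<lambda>x. \<Sum>j. y j x) \<le> (\<Sum>j. schwartz_seminorm \<alpha> is (y j))"
    by (rule schwartz_seminorm_least) (rule *)
qed

lemma graded_seminorm_series:
  "graded_seminorm N (\<lambda>x. \<Sum>j. y j x) \<le> (\<Sum>j. graded_seminorm N (y j))"
proof -
  have "graded_seminorm N (\<lambda>x. \<Sum>j. y j x) \<le>
      (\<Sum>k<N. \<Sum>j. nth_seminorm k (y j))"
    unfolding graded_seminorm_def by (rule sum_mono) (simp add: case_prod_beta schwartz_series(2))
  also have "\<dots> = (\<Sum>j. graded_seminorm N (y j))"
    unfolding graded_seminorm_def by (rule suminf_sum[symmetric]) (simp add: case_prod_beta sm)
  finally show ?thesis .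
qed

end

section \<open>Continuity in terms of seminorm bounds\<close>

text \<open>For linear \<open>T\<close> this is continuity. The codomain is an arbitrary normed space because the notion
  is also applied to real-valued seminorms.\<close>

definition dominated ::
    "((real ^ 'n::finite \<Rightarrow> 'k::real_normed_field) \<Rightarrow> 'b::real_normed_vector) \<Rightarrow> bool"
  where "dominated T \<longleftrightarrow> (\<exists>N C. \<forall>f\<in>schwartz_space. norm (T f) \<le> C * graded_seminorm N f)"

lemma dominatedE:
  assumes "dominated T"
  obtains N C where "0 \<le> C" "\<And>f. f \<in> schwartz_space \<Longrightarrow> norm (T f) \<le> C * graded_seminorm N f"
proof -
  from assms obtain N C where NC: "\<And>f. f \<in> schwartz_space \<Longrightarrow> norm (T f) \<le> C * graded_seminorm N f"
    by (auto simp: dominated_def)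
  have "norm (T f) \<le> \<bar>C\<bar> * graded_seminorm N f" if "f \<in> schwartz_space" for f
    using NC[OF that] graded_seminorm_nonneg[OF that]
    by (meson abs_ge_self mult_right_mono order_trans)
  then show thesis by (rule that[OF abs_ge_zero])
qed

lemma dominated_add:
  assumes "dominated S" "dominated T"
  shows "dominated (\<lambda>f. S f + T f)"
proof -
  obtain M C where C: "0 \<le> C" "\<And>f. f \<in> schwartz_space \<Longrightarrow> norm (S f) \<le> C * graded_seminorm M f"
    by (rule dominatedE[OF assms(1)]) (rule that)
  obtain N D where D: "0 \<le> D" "\<And>f. f \<in> schwartz_space \<Longrightarrow> norm (T f) \<le> D * graded_seminorm N f"
    by (rule dominatedE[OF assms(2)]) (rule that)
  have "norm (S f + T f) \<le> (C + D) * graded_seminorm (max M N) f" if f: "f \<in> schwartz_space" for f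
  proof -
    have "norm (S f + T f) \<le> C * graded_seminorm M f + D * graded_seminorm N f"
      using C(2)[OF f] D(2)[OF f] by (rule norm_triangle_mono)
    also have "\<dots> \<le> C * graded_seminorm (max M N) f + D * graded_seminorm (max M N) f"
      using C(1) D(1) by (intro add_mono mult_left_mono graded_seminorm_mono f) auto
    finally show ?thesis by (simp add: distrib_right)
  qed
  then show ?thesis unfolding dominated_def by blast
qed

lemma dominated_by:
  assumes "dominated T" "\<And>f. f \<in> schwartz_space \<Longrightarrow> norm (S f) \<le> B * norm (T f)" "0 \<le> B"
  shows "dominated S"
proof -
  obtain N C where C: "0 \<le> C" "\<And>f. f \<in> schwartz_space \<Longrightarrow> norm (T f) \<le> C * graded_seminorm N f"
    by (rule dominatedE[OF assms(1)]) (rule that)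
  have "norm (S f) \<le> (B * C) * graded_seminorm N f" if f: "f \<in> schwartz_space" for f
    using order_trans[OF assms(2)[OF f] mult_left_mono[OF C(2)[OF f] assms(3)]]
    by (simp add: mult.assoc)
  then show ?thesis unfolding dominated_def by blast
qed

text \<open>Linearity without extensionality, so that it applies to functionals given by plain
  abstractions.\<close>

definition linear_on_schwartz ::
    "((real ^ 'n::finite \<Rightarrow> 'k::real_normed_field) \<Rightarrow> 'k) \<Rightarrow> bool"
  where "linear_on_schwartz T \<longleftrightarrow>
    (\<forall>f\<in>schwartz_space. \<forall>g\<in>schwartz_space. T (\<lambda>x. f x + g x) = T f + T g) \<and>
    (\<forall>c. \<forall>f\<in>schwartz_space. T (\<lambda>x. c * f x) = c * T f)"

lemma linear_on_schwartzD:
  assumes "linear_on_schwartz T" "f \<in> schwartz_space"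
  shows "g \<in> schwartz_space \<Longrightarrow> T (\<lambda>x. f x + g x) = T f + T g"
    and "g \<in> schwartz_space \<Longrightarrow> T (\<lambda>x. f x - g x) = T f - T g"
    and "T (\<lambda>x. c * f x) = c * T f"
proof -
  show *: "T (\<lambda>x. f x + g x) = T f + T g" if "g \<in> schwartz_space" for g
    using assms that by (auto simp: linear_on_schwartz_def)
  show "T (\<lambda>x. c * f x) = c * T f" 
    using assms by (auto simp: linear_on_schwartz_def)
  assume g: "g \<in> schwartz_space"
  then have "T (\<lambda>x. - 1 * g x) = - 1 * T g"
    using assms unfolding linear_on_schwartz_def by blast
  then show "T (\<lambda>x. f x - g x) = T f - T g"
    using *[OF schwartz_cmult(1)[OF g, of "- 1"]] by simp
qed

text \<open>The topology is given by a subbasis of balls with arbitrary centres. Together with the lemma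
  after it, the following shows that the graded balls centred at a point are a neighbourhood base there.\<close>

lemma openin_contains_graded_ball:
  fixes U :: "(real ^ 'n::finite \<Rightarrow> 'k::real_normed_field) set"
  assumes "openin schwartz_topology U" "f \<in> U"
  shows "\<exists>N e. 0 < e \<and> {g \<in> schwartz_space. graded_seminorm N (\<lambda>x. g x - f x) < e} \<subseteq> U"
proof -
  have "f \<in> U \<longrightarrow>
      (\<exists>N e. 0 < e \<and> {g \<in> schwartz_space. graded_seminorm N (\<lambda>x. g x - f x) < e} \<subseteq> U)"
    using assms(1)[unfolded schwartz_topology_def, THEN openin_topology_generated_by]
  proof induction
    case (Int U V)
    show ?case
    proof
      assume f: "f \<in> U \<inter> V"
      then have "f \<in> topspace schwartz_topology"
        using Int.hyps unfolding openin_topology_generated_by_iff[symmetric] schwartz_topology_def[symmetric]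
        using openin_subset by fastforce
      then have fS: "f \<in> schwartz_space" by (simp add: topspace_schwartz_topology)
      from f Int.IH obtain M d where M: "0 < d"
          "{g \<in> schwartz_space. graded_seminorm M (\<lambda>x. g x - f x) < d} \<subseteq> U" by blast
      from f Int.IH obtain N e where N: "0 < e"
          "{g \<in> schwartz_space. graded_seminorm N (\<lambda>x. g x - f x) < e} \<subseteq> V" by blast
      have "g \<in> U \<inter> V" if g: "g \<in> schwartz_space"
          and lt: "graded_seminorm (max M N) (\<lambda>x. g x - f x) < min d e" for g
      proof -
        have "graded_seminorm K (\<lambda>x. g x - f x) < min d e" if "K \<le> max M N" for K
          using graded_seminorm_mono[OF schwartz_diff[OF g fS] that] lt by simp
        from this[of M] this[of N] show ?thesis using M N g by auto
      qed
      then have "{g \<in> schwartz_space. graded_seminorm (max M N) (\<lambda>x. g x - f x) < min d e} \<subseteq> U \<inter> V"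
        by blast
      moreover have "0 < min d e" using M N by simp
      ultimately show "\<exists>N e. 0 < e \<and>
          {g \<in> schwartz_space. graded_seminorm N (\<lambda>x. g x - f x) < e} \<subseteq> U \<inter> V" by blast
    qed
  next
    case (UN K)
    show ?case
    proof
      assume "f \<in> \<Union>K"
      then obtain V where V: "V \<in> K" "f \<in> V" by blast
      with UN.IH[OF V(1)] obtain N e where
        "0 < e" "{g \<in> schwartz_space. graded_seminorm N (\<lambda>x. g x - f x) < e} \<subseteq> V" by blast
      with V(1) show "\<exists>N e. 0 < e \<and>
          {g \<in> schwartz_space. graded_seminorm N (\<lambda>x. g x - f x) < e} \<subseteq> \<Union>K" by blast
    qed
  next
    case (Basis U)
    then obtain \<alpha> "is" h e where U: "U = {g \<in> schwartz_space. schwartz_seminorm \<alpha> is (\<lambda>x. g x - h x) < e}"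
      and h: "h \<in> schwartz_space" by blast
    show ?case
    proof
      assume "f \<in> U"
      then have f: "f \<in> schwartz_space" and lt: "schwartz_seminorm \<alpha> is (\<lambda>x. f x - h x) < e"
        by (auto simp: U)
      obtain N where N: "\<And>g :: real ^ 'n \<Rightarrow> 'k. g \<in> schwartz_space \<Longrightarrow> schwartz_seminorm \<alpha> is g \<le> graded_seminorm N g"
        using schwartz_seminorm_le_graded by blast
      let ?d = "e - schwartz_seminorm \<alpha> is (\<lambda>x. f x - h x)"
      have "g \<in> U" if g: "g \<in> schwartz_space" and "graded_seminorm N (\<lambda>x. g x - f x) < ?d" for g
      proof -
        have "schwartz_seminorm \<alpha> is (\<lambda>x. (g x - f x) + (f x - h x))
          \<le> schwartz_seminorm \<alpha> is (\<lambda>x. g x - f x) + schwartz_seminorm \<alpha> is (\<lambda>x. f x - h x)"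
          by (rule schwartz_add(2)) (intro schwartz_diff f g h)+
        also have "\<dots> < e"
          using N[OF schwartz_diff[OF g f]] that by simp
        finally show ?thesis using g by (simp add: U)
      qed
      then have "{g \<in> schwartz_space. graded_seminorm N (\<lambda>x. g x - f x) < ?d} \<subseteq> U" by blast
      moreover have "0 < ?d" using lt by simp
      ultimately show "\<exists>N e. 0 < e \<and>
          {g \<in> schwartz_space. graded_seminorm N (\<lambda>x. g x - f x) < e} \<subseteq> U" by blast
    qed
  qed simp
  with assms(2) show ?thesis by blast
qed

lemma graded_ball_contains_openin:
  fixes f :: "real ^ 'n::finite \<Rightarrow> 'k::real_normed_field"
  assumes f: "f \<in> schwartz_space" and "0 < e"
  shows "\<exists>V. openin schwartz_topology V \<and> f \<in> V \<and>
    V \<subseteq> {g \<in> schwartz_space. graded_seminorm N (\<lambda>x. g x - f x) < e}"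
  using assms(2)
proof (induction N arbitrary: e)
  case 0
  then show ?case
    using f openin_topspace[of schwartz_topology]
    by (intro exI[of _ schwartz_space]) (auto simp: graded_seminorm_def topspace_schwartz_topology)
next
  case (Suc N)
  then obtain V where V: "openin schwartz_topology V" "f \<in> V"
      "V \<subseteq> {g \<in> schwartz_space. graded_seminorm N (\<lambda>x. g x - f x) < e / 2}"
    using Suc.IH[of "e / 2"] by auto
  obtain \<alpha> "is" where idx: "(from_nat N :: ('n \<Rightarrow> nat) \<times> 'n list) = (\<alpha>, is)" by fastforce
  let ?B = "{g \<in> schwartz_space. schwartz_seminorm \<alpha> is (\<lambda>x. g x - f x) < e / 2}"
  have "openin schwartz_topology ?B"
    unfolding schwartz_topology_def
    by (rule topology_generated_by_Basis) (use f half_gt_zero[OF Suc.prems] in blast)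
  moreover have "f \<in> ?B"
    using f Suc.prems by (simp add: schwartz_seminorm_zero)
  moreover have "V \<inter> ?B \<subseteq> {g \<in> schwartz_space. graded_seminorm (Suc N) (\<lambda>x. g x - f x) < e}"
    using V(3) by (auto simp: graded_seminorm_def idx)
  ultimately show ?case
    using V by (intro exI[of _ "V \<inter> ?B"]) auto
qed

text \<open>A continuous functional is below 1 in norm on some graded ball around zero; if \<open>f\<close> violated
  the resulting bound, the multiple of \<open>f\<close> on which the functional has norm 1 would lie
  in that ball.\<close>

lemma tempered_distributions_iff:
  fixes a :: "(real ^ 'n::finite \<Rightarrow> 'k::real_normed_field) \<Rightarrow> 'k"
  shows "a \<in> tempered_distributions \<longleftrightarrow>
    a \<in> extensional schwartz_space \<and> linear_on_schwartz a \<and> dominated a"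
proof -
  have "continuous_map schwartz_topology euclidean a \<longleftrightarrow> dominated a"
    if lin: "linear_on_schwartz a"
  proof
    assume "continuous_map schwartz_topology euclidean a"
    then have open_U: "openin schwartz_topology {f \<in> topspace schwartz_topology. a f \<in> ball 0 1}"
      (is "openin _ ?U") by (rule openin_continuous_map_preimage) simp
    have "a (\<lambda>x. 0) = 0"
      using linear_on_schwartzD(3)[OF lin schwartz_zero, of 0] by simp
    then have "(\<lambda>x. 0) \<in> ?U"
      by (simp add: topspace_schwartz_topology schwartz_zero)
    from openin_contains_graded_ball[OF open_U this] obtain N e where e: "0 < e"
      and U: "{g \<in> schwartz_space. graded_seminorm N g < e} \<subseteq> ?U"
      by auto
    have "norm (a f) \<le> (1 / e) * graded_seminorm N f" if f: "f \<in> schwartz_space" for f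
    proof (rule ccontr)
      assume gt: "\<not> norm (a f) \<le> (1 / e) * graded_seminorm N f"
      then have pos: "0 < norm (a f)"
        using graded_seminorm_nonneg[OF f, of N] e
        by (smt (verit) divide_nonneg_pos mult_nonneg_nonneg)
      let ?g = "\<lambda>x. of_real (1 / norm (a f)) * f x :: 'k"
      have "graded_seminorm N ?g \<le> (1 / norm (a f)) * graded_seminorm N f"
        using graded_seminorm_cmult[OF f, of N "of_real (1 / norm (a f))", unfolded norm_of_real]
        by simp
      also have "\<dots> < e"
        using gt pos e by (simp add: field_simps)
      finally have "?g \<in> ?U"
        using U schwartz_cmult(1)[OF f] by blast
      then have "norm (a ?g) < 1" by simp
      moreover have "norm (a ?g) = 1"
        using pos by (simp only: linear_on_schwartzD(3)[OF lin f] norm_mult norm_of_real) simp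
      ultimately show False by simp
    qed
    then show "dominated a" unfolding dominated_def by blast
  next
    assume "dominated a"
    then obtain N C where C: "0 \<le> C" "\<And>f. f \<in> schwartz_space \<Longrightarrow> norm (a f) \<le> C * graded_seminorm N f"
      by (rule dominatedE) (rule that)
    have "openin schwartz_topology {f \<in> schwartz_space. a f \<in> U}" if U: "open U" for U
    proof (subst openin_subopen, intro ballI)
      fix f assume "f \<in> {f \<in> schwartz_space. a f \<in> U}"
      then have f: "f \<in> schwartz_space" "a f \<in> U" by auto
      then obtain e where e: "0 < e" "ball (a f) e \<subseteq> U"
        using U openE by blast
      have "0 < e / (C + 1)" using C(1) e(1) by simp
      then obtain V where V: "openin schwartz_topology V" "f \<in> V"
          "V \<subseteq> {g \<in> schwartz_space. graded_seminorm N (\<lambda>x. g x - f x) < e / (C + 1)}"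
        using graded_ball_contains_openin[OF f(1)] by blast
      have "a g \<in> U" if "g \<in> V" for g
      proof -
        have g: "g \<in> schwartz_space" and lt: "graded_seminorm N (\<lambda>x. g x - f x) < e / (C + 1)"
          using V(3) that by auto
        have "norm (a g - a f) = norm (a (\<lambda>x. g x - f x))"
          by (simp add: linear_on_schwartzD(2)[OF lin g f(1)])
        also have "\<dots> \<le> C * graded_seminorm N (\<lambda>x. g x - f x)"
          by (rule C(2)[OF schwartz_diff[OF g f(1)]])
        also have "\<dots> \<le> (C + 1) * graded_seminorm N (\<lambda>x. g x - f x)"
          by (rule mult_right_mono) (simp_all add: graded_seminorm_nonneg schwartz_diff g f)
        also have "\<dots> < e"
          using lt C(1) by (simp add: field_simps)
        finally show ?thesis
          using e(2) by (auto simp: dist_norm norm_minus_commute)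
      qed
      then show "\<exists>T. openin schwartz_topology T \<and> f \<in> T \<and> T \<subseteq> {f \<in> schwartz_space. a f \<in> U}"
        using V by blast
    qed
    then show "continuous_map schwartz_topology euclidean a"
      by (simp add: continuous_map_def topspace_schwartz_topology)
  qed
  then show ?thesis
    unfolding tempered_distributions_def linear_functional_def linear_on_schwartz_def by blast
qed

section \<open>Uniform boundedness on the Schwartz space\<close>

text \<open>A gliding hump argument. If the family is not equicontinuous, then arbitrarily small
  perturbations make some member arbitrarily large. This yields a sequence \<open>x j\<close> and indices \<open>i j\<close>
  with \<open>norm (T (i j) (x j)) > j\<close>, in which every step is so small that all later steps together
  change \<open>T (i j)\<close> by at most 1, which is possible because \<open>T (i j)\<close> is continuous. The limit of the
  sequence, which exists by completeness, violates pointwise boundedness.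

  It does not matter how \<open>T (i (j + 1))\<close> behaves at \<open>x j\<close>: of \<open>x j + y\<close> and \<open>x j - y\<close>, one has an image
  at least as large as that of \<open>y\<close>, since the difference of the two images is twice that of \<open>y\<close>.\<close>

theorem schwartz_uniform_boundedness:
  fixes T :: "'i \<Rightarrow> (real ^ 'n::finite \<Rightarrow> 'k::{real_normed_field, banach}) \<Rightarrow> 'k"
  assumes lin: "\<And>i. linear_on_schwartz (T i)"
    and dom: "\<And>i. dominated (T i)"
    and bdd: "\<And>f. f \<in> schwartz_space \<Longrightarrow> \<exists>B. \<forall>i. norm (T i f) \<le> B"
  shows "\<exists>N C. \<forall>i. \<forall>f\<in>schwartz_space. norm (T i f) \<le> C * graded_seminorm N f"
proof (rule ccontr)
  assume "\<not> ?thesis"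
  then have unbdd: "\<exists>i. \<exists>f\<in>schwartz_space. C * graded_seminorm N f < norm (T i f)" for N C
    by (meson not_le)
  \<comment> \<open>rescaling a violation of the bound by \<open>(K + 1) / e\<close> to norm \<open>K + 1\<close> makes its seminorm small\<close>
  have big: "\<exists>i. \<exists>y\<in>schwartz_space. graded_seminorm N y \<le> e \<and> K < norm (T i y)"
    if "0 < e" "0 \<le> K" for N e K
  proof -
    obtain i f where f: "f \<in> schwartz_space" and gt: "((K + 1) / e) * graded_seminorm N f < norm (T i f)"
      using unbdd by blast
    have pos: "0 < norm (T i f)"
      using gt graded_seminorm_nonneg[OF f, of N] that
      by (smt (verit) divide_nonneg_pos mult_nonneg_nonneg)
    let ?c = "(K + 1) / norm (T i f)"
    have c: "0 \<le> ?c" using that by simp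
    have "graded_seminorm N (\<lambda>x. of_real ?c * f x) \<le> ?c * graded_seminorm N f"
      using graded_seminorm_cmult[OF f, of N "of_real ?c", unfolded norm_of_real abs_of_nonneg[OF c]] .
    also have "\<dots> \<le> e"
      using gt pos that by (simp add: field_simps)
    finally have "graded_seminorm N (\<lambda>x. of_real ?c * f x) \<le> e" .
    moreover have "norm (T i (\<lambda>x. of_real ?c * f x)) = K + 1"
      unfolding linear_on_schwartzD(3)[OF lin f] norm_mult norm_of_real abs_of_nonneg[OF c]
      using pos by simp
    ultimately show ?thesis
      using schwartz_cmult(1)[OF f, of "of_real ?c"] by (metis less_add_one)
  qed
  have nbhd: "\<exists>N\<ge>M. \<exists>r. 0 < r \<and> r \<le> d \<and>
      (\<forall>f\<in>schwartz_space. graded_seminorm N f \<le> r \<longrightarrow> norm (T i f) \<le> 1)"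
    if "0 < d" for i M d
  proof -
    obtain N C where C: "0 \<le> C" "\<And>f. f \<in> schwartz_space \<Longrightarrow> norm (T i f) \<le> C * graded_seminorm N f"
      by (rule dominatedE[OF dom]) (rule that)
    let ?r = "min d (1 / (C + 1))"
    have "norm (T i f) \<le> 1" if f: "f \<in> schwartz_space" and r: "graded_seminorm (max M N) f \<le> ?r" for f
    proof -
      have "norm (T i f) \<le> C * graded_seminorm N f" by (rule C(2)[OF f])
      also have "\<dots> \<le> C * (1 / (C + 1))"
        using r graded_seminorm_mono[OF f, of N "max M N"] C(1) by (intro mult_left_mono) auto
      also have "\<dots> \<le> 1" using C(1) by simp
      finally show ?thesis .
    qed
    moreover have "0 < ?r" using C(1) that by simp
    ultimately show ?thesis
      by (intro exI[of _ "max M N"] conjI exI[of _ ?r]) auto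
  qed
  \<comment> \<open>A state consists of the current point, the index of a functional that is large there, and a
    neighbourhood of zero, given by a seminorm and a radius, on which that functional is at most 1.
    Halving the radii keeps the sum of all later steps in this neighbourhood; the seminorm indices
    tend to infinity so that the steps are summable in every seminorm.\<close>
  define P where "P j = (\<lambda>(x, i, N, r). x \<in> schwartz_space \<and> real j < norm (T i x) \<and> j \<le> N \<and> 0 < r \<and>
    (\<forall>f\<in>schwartz_space. graded_seminorm N f \<le> r \<longrightarrow> norm (T i f) \<le> 1))" for j
  define R where "R = (\<lambda>(x :: real ^ 'n \<Rightarrow> 'k, i :: 'i, N, r :: real) (x', i' :: 'i, N' :: nat, r').
    graded_seminorm N (\<lambda>t. x' t - x t) \<le> r / 2 \<and> N \<le> N' \<and> r' \<le> r / 2)"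
  have "\<exists>s. \<forall>j. P j (s j) \<and> R (s j) (s (Suc j))"
  proof (rule dependent_nat_choice)
    obtain i x where x: "x \<in> schwartz_space" "0 < norm (T i x)"
      using big[of 1 0 0] by auto
    obtain N r where "0 < r" "\<forall>f\<in>schwartz_space. graded_seminorm N f \<le> r \<longrightarrow> norm (T i f) \<le> 1"
      using nbhd[of 1 0 i] by auto
    with x show "\<exists>s. P 0 s"
      by (intro exI[of _ "(x, i, N, r)"]) (simp add: P_def)
  next
    fix s j
    assume s: "P j s"
    obtain x i N r where s_eq: "s = (x, i, N, r)" using prod_cases4 by blast
    have x: "x \<in> schwartz_space" "0 < r" using s by (auto simp: s_eq P_def)
    obtain i' y where y: "y \<in> schwartz_space" "graded_seminorm N y \<le> r / 2"
        "real (Suc j) < norm (T i' y)"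
      using big[of "r / 2" "real (Suc j)" N] x by auto
    have "2 * T i' y = T i' (\<lambda>t. x t + y t) - T i' (\<lambda>t. x t - y t)"
      using linear_on_schwartzD(1,2)[OF lin x(1) y(1), of i'] by simp
    then have "norm (2 * T i' y) \<le> norm (T i' (\<lambda>t. x t + y t)) + norm (T i' (\<lambda>t. x t - y t))"
      by (simp only: norm_triangle_ineq4)
    then have "2 * norm (T i' y) \<le> norm (T i' (\<lambda>t. x t + y t)) + norm (T i' (\<lambda>t. x t - y t))"
      by (simp only: norm_mult norm_numeral)
    then consider "norm (T i' y) \<le> norm (T i' (\<lambda>t. x t + y t))"
      | "norm (T i' y) \<le> norm (T i' (\<lambda>t. x t - y t))" by linarith
    then obtain x' where x': "x' \<in> schwartz_space" "norm (T i' y) \<le> norm (T i' x')"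
        "graded_seminorm N (\<lambda>t. x' t - x t) \<le> r / 2"
    proof cases
      case 1
      with y show thesis by (intro that[of "\<lambda>t. x t + y t"] schwartz_add x) auto
    next
      case 2
      have "graded_seminorm N (\<lambda>t. - y t) \<le> r / 2"
        using graded_seminorm_cmult[OF y(1), of N "- 1"] y(2) by simp
      with 2 y show thesis by (intro that[of "\<lambda>t. x t - y t"] schwartz_diff x) auto
    qed
    obtain N' r' where N': "max (Suc j) N \<le> N'" "0 < r'" "r' \<le> r / 2"
        "\<forall>f\<in>schwartz_space. graded_seminorm N' f \<le> r' \<longrightarrow> norm (T i' f) \<le> 1"
      using nbhd[of "r / 2" "max (Suc j) N" i'] x(2) by auto
    have "P (Suc j) (x', i', N', r')"
      using x' y(3) N' by (auto simp: P_def)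
    moreover have "R s (x', i', N', r')"
      using x' N' by (auto simp: R_def s_eq)
    ultimately show "\<exists>s'. P (Suc j) s' \<and> R s s'" by blast
  qed
  then obtain s where s: "\<And>j. P j (s j)" "\<And>j. R (s j) (s (Suc j))" by blast
  define x i N r where "x j = fst (s j)" and "i j = fst (snd (s j))"
    and "N j = fst (snd (snd (s j)))" and "r j = snd (snd (snd (s j)))" for j
  have x: "x j \<in> schwartz_space" and big_x: "real j < norm (T (i j) (x j))" and j_le: "j \<le> N j"
    and r_pos: "0 < r j"
    and ctrl: "\<And>f. f \<in> schwartz_space \<Longrightarrow> graded_seminorm (N j) f \<le> r j \<Longrightarrow> norm (T (i j) f) \<le> 1" for j
    using s(1)[of j] by (auto simp: P_def x_def i_def N_def r_def case_prod_beta)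
  have step: "graded_seminorm (N j) (\<lambda>t. x (Suc j) t - x j t) \<le> r j / 2"
    and N_mono: "N j \<le> N (Suc j)" and r_half: "r (Suc j) \<le> r j / 2" for j
    using s(2)[of j] by (auto simp: R_def x_def i_def N_def r_def case_prod_beta)
  define y where "y j = (\<lambda>t. x (Suc j) t - x j t)" for j
  have y: "y j \<in> schwartz_space" for j
    unfolding y_def by (rule schwartz_diff[OF x x])
  have y_small: "graded_seminorm (N j) (y (k + j)) \<le> r j * (1 / 2) ^ Suc k" for j k
  proof -
    have r_le: "r (k + j) \<le> r j * (1 / 2) ^ k" for k
    proof (induction k)
      case (Suc k)
      have "r (Suc k + j) \<le> (r j * (1 / 2) ^ k) / 2"
        using r_half[of "k + j"] Suc by simp
      then show ?case by (simp add: mult.commute)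
    qed simp
    have "N j \<le> N (k + j)"
      using lift_Suc_mono_le[of N, OF N_mono] by simp
    then have "graded_seminorm (N j) (y (k + j)) \<le> graded_seminorm (N (k + j)) (y (k + j))"
      by (rule graded_seminorm_mono[OF y])
    also have "\<dots> \<le> r (k + j) / 2"
      unfolding y_def by (rule step)
    finally show ?thesis using r_le[of k] by simp
  qed
  have sm: "summable (\<lambda>k. schwartz_seminorm \<alpha> is (y (k + j)))" for \<alpha> "is" j
  proof -
    obtain M where M: "\<And>f :: real ^ 'n \<Rightarrow> 'k. f \<in> schwartz_space \<Longrightarrow>
        schwartz_seminorm \<alpha> is f \<le> graded_seminorm M f"
      using schwartz_seminorm_le_graded by blast
    have "summable (\<lambda>k. schwartz_seminorm \<alpha> is (y (k + M)))"
    proof (rule summable_comparison_test'[of "\<lambda>k. r M * (1 / 2) ^ Suc k" 0])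
      show "summable (\<lambda>k. r M * (1 / 2) ^ Suc k)"
        by (intro summable_mult) (simp add: summable_geometric)
      fix k
      have "schwartz_seminorm \<alpha> is (y (k + M)) \<le> graded_seminorm (N M) (y (k + M))"
        using M[OF y] graded_seminorm_mono[OF y j_le] order_trans by blast
      also have "\<dots> \<le> r M * (1 / 2) ^ Suc k" by (rule y_small)
      finally show "norm (schwartz_seminorm \<alpha> is (y (k + M))) \<le> r M * (1 / 2) ^ Suc k"
        by (simp add: schwartz_seminorm_nonneg y)
    qed
    then have "summable (\<lambda>k. schwartz_seminorm \<alpha> is (y k))"
      by (rule summable_iff_shift[of "\<lambda>k. schwartz_seminorm \<alpha> is (y k)" M, THEN iffD1])
    then show ?thesis
      by (rule summable_ignore_initial_segment)
  qed
  define tail where "tail j = (\<lambda>t. \<Sum>k. y (k + j) t)" for j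
  have tail: "tail j \<in> schwartz_space" for j
    unfolding tail_def by (rule schwartz_series(1)[OF y sm])
  have tail_small: "graded_seminorm (N j) (tail j) \<le> r j" for j
  proof -
    have geo: "(\<lambda>k. r j * (1 / 2) ^ Suc k) sums (r j * 1)"
      by (intro sums_mult power_half_series)
    have "summable (\<lambda>k. graded_seminorm (N j) (y (k + j)))"
      by (rule summable_comparison_test'[OF sums_summable[OF geo], of 0])
        (use y_small graded_seminorm_nonneg[OF y] in auto)
    then have "(\<Sum>k. graded_seminorm (N j) (y (k + j))) \<le> r j"
      using suminf_le[OF y_small _ sums_summable[OF geo]] sums_unique[OF geo] by simp
    then show ?thesis
      using graded_seminorm_series[OF y sm, of "N j" j] by (simp add: tail_def)
  qed
  define X where "X = (\<lambda>t. x 0 t + tail 0 t)"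
  have X: "X \<in> schwartz_space" unfolding X_def by (rule schwartz_add(1)[OF x tail])
  have X_eq: "X = (\<lambda>t. x j t + tail j t)" for j
  proof
    fix t
    have "summable (\<lambda>k. y k t)"
      using summable_iter_partial_deriv[of y "[]" t] y sm[of _ _ 0] by simp
    then have "tail 0 t = tail j t + (\<Sum>k<j. y k t)"
      unfolding tail_def using suminf_split_initial_segment[of "\<lambda>k. y k t" j] by simp
    also have "(\<Sum>k<j. y k t) = x j t - x 0 t"
      unfolding y_def by (rule sum_lessThan_telescope)
    finally show "X t = x j t + tail j t" by (simp add: X_def)
  qed
  have "real j - 1 < norm (T (i j) X)" for j
  proof -
    have "T (i j) X = T (i j) (x j) + T (i j) (tail j)"
      by (subst X_eq[of j]) (rule linear_on_schwartzD(1)[OF lin x tail])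
    moreover have "norm (T (i j) (tail j)) \<le> 1"
      by (rule ctrl[OF tail tail_small])
    ultimately show ?thesis
      using big_x[of j] norm_diff_ineq[of "T (i j) (x j)" "T (i j) (tail j)"] by simp
  qed
  moreover obtain B where "\<And>i. norm (T i X) \<le> B" using bdd[OF X] by blast
  moreover obtain j where "B + 1 < real j" using reals_Archimedean2 by blast
  ultimately show False by (smt (verit))
qed

section \<open>The operator generated by a Schwartz family\<close>

lemma has_derivative_difference_quotients:
  assumes "(f has_derivative f') (at x)"
  shows "(\<lambda>k. real (Suc k) *\<^sub>R (f (x + (1 / real (Suc k)) *\<^sub>R h) - f x)) \<longlonglongrightarrow> f' h"
proof -
  interpret bounded_linear f' by (rule has_derivative_bounded_linear[OF assms])
  have "((\<lambda>t. f (x + t *\<^sub>R h)) has_derivative (\<lambda>t. f' (t *\<^sub>R h))) (at 0)"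
    by (rule has_derivative_compose[where g = f and f = "\<lambda>t. x + t *\<^sub>R h"])
      (auto intro!: derivative_eq_intros simp: assms)
  then have "((\<lambda>t. norm (f (x + t *\<^sub>R h) - f x - f' (t *\<^sub>R h)) / norm t) \<longlongrightarrow> 0) (at 0)"
    by (simp add: has_derivative_iff_norm)
  moreover have "filterlim (\<lambda>k. 1 / real (Suc k)) (at 0) sequentially"
    using LIMSEQ_inverse_real_of_nat by (simp add: filterlim_at inverse_eq_divide)
  ultimately have "(\<lambda>k. norm (f (x + (1 / real (Suc k)) *\<^sub>R h) - f x - f' ((1 / real (Suc k)) *\<^sub>R h))
      / norm (1 / real (Suc k))) \<longlonglongrightarrow> 0"
    by (rule filterlim_compose)
  moreover have "norm (f (x + (1 / real (Suc k)) *\<^sub>R h) - f x - f' ((1 / real (Suc k)) *\<^sub>R h))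
      / norm (1 / real (Suc k))
    = norm (real (Suc k) *\<^sub>R (f (x + (1 / real (Suc k)) *\<^sub>R h) - f x) - f' h)" for k
  proof -
    have "norm (real (Suc k) *\<^sub>R (f (x + (1 / real (Suc k)) *\<^sub>R h) - f x) - f' h)
      = norm (real (Suc k) *\<^sub>R (f (x + (1 / real (Suc k)) *\<^sub>R h) - f x - f' ((1 / real (Suc k)) *\<^sub>R h)))"
      by (simp add: scaleR scaleR_diff_right)
    also have "\<dots> = real (Suc k) * norm (f (x + (1 / real (Suc k)) *\<^sub>R h) - f x - f' ((1 / real (Suc k)) *\<^sub>R h))"
      by (simp only: norm_scaleR abs_of_nat)
    finally show ?thesis by simp
  qed
  ultimately show ?thesis
    by (simp add: LIM_zero_cancel tendsto_norm_zero_iff)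
qed

context
  fixes v :: "real ^ 'm::finite \<Rightarrow> (real ^ 'n::finite \<Rightarrow> 'k::{real_normed_field, banach}) \<Rightarrow> 'k"
  assumes v: "v \<in> schwartz_families"
begin

lemma family_image_schwartz: "\<phi> \<in> schwartz_space \<Longrightarrow> family_image v \<phi> \<in> schwartz_space"
  using v by (simp add: schwartz_families_def)

lemma family_member: "linear_on_schwartz (v p)" "dominated (v p)"
  using v by (auto simp: schwartz_families_def tempered_distributions_iff)

lemma family_image_add:
  "f \<in> schwartz_space \<Longrightarrow> g \<in> schwartz_space \<Longrightarrow>
    family_image v (\<lambda>x. f x + g x) = (\<lambda>p. family_image v f p + family_image v g p)"
  by (simp add: family_image_def linear_on_schwartzD(1)[OF family_member(1)])

lemma family_image_cmult:
  "f \<in> schwartz_space \<Longrightarrow> family_image v (\<lambda>x. c * f x) = (\<lambda>p. c * family_image v f p)"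
  by (simp add: family_image_def linear_on_schwartzD(3)[OF family_member(1)])

lemma linear_iter_partial_deriv_family_image:
  "linear_on_schwartz (\<lambda>\<phi>. iter_partial_deriv is (family_image v \<phi>) x)"
  by (simp add: linear_on_schwartz_def family_image_add family_image_cmult iter_partial_deriv_add
      iter_partial_deriv_cmult schwartz_smooth family_image_schwartz)

text \<open>The difference quotients of the previous derivative are continuous in \<open>\<phi>\<close> and converge
  for each \<open>\<phi>\<close>. By uniform boundedness they share one seminorm bound, which passes to the limit.\<close>

lemma dominated_iter_partial_deriv_family_image:
  "dominated (\<lambda>\<phi>. iter_partial_deriv is (family_image v \<phi>) x)"
proof (induction "is" arbitrary: x)
  case Nil
  then show ?case using family_member(2) by (simp add: family_image_def)
next
  case (Cons i "is")
  let ?D = "\<lambda>x \<phi>. iter_partial_deriv is (family_image v \<phi>) x"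
  define T where "T k \<phi> = real (Suc k) *\<^sub>R (?D (x + (1 / real (Suc k)) *\<^sub>R axis i 1) \<phi> - ?D x \<phi>)" for k \<phi>
  have lim: "(\<lambda>k. T k \<phi>) \<longlonglongrightarrow> iter_partial_deriv (i # is) (family_image v \<phi>) x"
    if "\<phi> \<in> schwartz_space" for \<phi>
  proof -
    have "iter_partial_deriv is (family_image v \<phi>) differentiable (at x)"
      by (rule smoothD[OF schwartz_smooth[OF family_image_schwartz[OF that]]])
    from has_derivative_difference_quotients[OF this[unfolded frechet_derivative_works], of "axis i 1"]
    show ?thesis by (simp add: T_def partial_deriv_def)
  qed
  have "\<exists>N C. \<forall>k. \<forall>\<phi>\<in>schwartz_space. norm (T k \<phi>) \<le> C * graded_seminorm N \<phi>"
  proof (rule schwartz_uniform_boundedness)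
    show "linear_on_schwartz (T k)" for k
      using linear_iter_partial_deriv_family_image
      unfolding linear_on_schwartz_def T_def by (simp add: algebra_simps)
    show "dominated (T k)" for k
    proof (rule dominated_by[where B = "real (Suc k)"])
      have "dominated (\<lambda>\<phi>. - ?D x \<phi>)"
        by (rule dominated_by[OF Cons.IH, where B = 1]) auto
      with Cons.IH show "dominated (\<lambda>\<phi>. ?D (x + (1 / real (Suc k)) *\<^sub>R axis i 1) \<phi> + - ?D x \<phi>)"
        by (rule dominated_add)
    qed (simp_all add: T_def)
    show "\<exists>B. \<forall>k. norm (T k \<phi>) \<le> B" if "\<phi> \<in> schwartz_space" for \<phi>
      using convergent_imp_Bseq[OF convergentI[OF lim[OF that]]] by (auto simp: Bseq_def)
  qed
  then obtain N C where C: "\<And>k \<phi>. \<phi> \<in> schwartz_space \<Longrightarrow> norm (T k \<phi>) \<le> C * graded_seminorm N \<phi>"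
    by blast
  have "norm (iter_partial_deriv (i # is) (family_image v \<phi>) x) \<le> C * graded_seminorm N \<phi>"
    if "\<phi> \<in> schwartz_space" for \<phi>
    using C[OF that] by (intro LIMSEQ_le_const2[OF tendsto_norm[OF lim[OF that]]]) blast
  then show ?case unfolding dominated_def by blast
qed

text \<open>Here the index of the family in the uniform boundedness principle is the point at which the
  weighted derivative is taken: a supremum of continuous functionals is bounded by a seminorm as soon
  as it is finite everywhere.\<close>

lemma dominated_schwartz_seminorm_family_image:
  "dominated (\<lambda>\<phi>. schwartz_seminorm \<alpha> is (family_image v \<phi>))"
proof -
  have "\<exists>N C. \<forall>x. \<forall>\<phi>\<in>schwartz_space.
    norm (weighted_deriv \<alpha> is (family_image v \<phi>) x) \<le> C * graded_seminorm N \<phi>"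
  proof (rule schwartz_uniform_boundedness)
    show "linear_on_schwartz (\<lambda>\<phi>. weighted_deriv \<alpha> is (family_image v \<phi>) x)" for x
      using linear_iter_partial_deriv_family_image
      unfolding linear_on_schwartz_def weighted_deriv_def by (simp add: scaleR_add_right)
    show "dominated (\<lambda>\<phi>. weighted_deriv \<alpha> is (family_image v \<phi>) x)" for x
      by (rule dominated_by[OF dominated_iter_partial_deriv_family_image])
        (auto simp: weighted_deriv_def)
    show "\<exists>B. \<forall>x. norm (weighted_deriv \<alpha> is (family_image v \<phi>) x) \<le> B"
      if "\<phi> \<in> schwartz_space" for \<phi>
      using norm_weighted_deriv_le[OF family_image_schwartz[OF that]] by blast
  qed
  then obtain N C where C: "\<And>x \<phi>. \<phi> \<in> schwartz_space \<Longrightarrow>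
      norm (weighted_deriv \<alpha> is (family_image v \<phi>) x) \<le> C * graded_seminorm N \<phi>" by blast
  have "norm (schwartz_seminorm \<alpha> is (family_image v \<phi>)) \<le> C * graded_seminorm N \<phi>"
    if "\<phi> \<in> schwartz_space" for \<phi>
    using schwartz_seminorm_least[OF C[OF that]]
    by (simp add: schwartz_seminorm_nonneg family_image_schwartz that)
  then show ?thesis unfolding dominated_def by blast
qed

lemma dominated_graded_seminorm_family_image:
  "dominated (\<lambda>\<phi>. graded_seminorm N (family_image v \<phi>))"
proof (induction N)
  case 0
  show ?case
    unfolding dominated_def graded_seminorm_def by (intro exI[of _ 0]) simp
next
  case (Suc N)
  have "dominated (\<lambda>\<phi>. nth_seminorm N (family_image v \<phi>))"
    by (simp add: case_prod_beta dominated_schwartz_seminorm_family_image)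
  from dominated_add[OF Suc this] show ?case by (simp add: graded_seminorm_def)
qed

proposition superposition_tempered:
  assumes a: "a \<in> tempered_distributions"
  shows "(\<lambda>\<phi>\<in>schwartz_space. a (generated_operator v \<phi>)) \<in> tempered_distributions"
proof -
  have lin: "linear_on_schwartz a" and dom: "dominated a"
    using a by (auto simp: tempered_distributions_iff)
  obtain N C where C: "0 \<le> C" "\<And>f. f \<in> schwartz_space \<Longrightarrow> norm (a f) \<le> C * graded_seminorm N f"
    by (rule dominatedE[OF dom]) (rule that)
  have "linear_on_schwartz (\<lambda>\<phi>\<in>schwartz_space. a (generated_operator v \<phi>))"
    by (simp add: linear_on_schwartz_def generated_operator_def schwartz_add schwartz_cmult
        family_image_add family_image_cmult family_image_schwartz linear_on_schwartzD[OF lin])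
  moreover have "dominated (\<lambda>\<phi>\<in>schwartz_space. a (generated_operator v \<phi>))"
    by (rule dominated_by[OF dominated_graded_seminorm_family_image[of N], of _ C])
      (use C in \<open>auto simp: generated_operator_def family_image_schwartz graded_seminorm_nonneg\<close>)
  ultimately show ?thesis
    by (simp add: tempered_distributions_iff)
qed

corollary schwartz_family_summable:
  "a \<in> tempered_distributions \<Longrightarrow> summable_wrt v a"
  using superposition_tempered[of a] by (simp add: summable_wrt_def compose_def)

end

theorem mainTheorem3:
  "(\<forall>v \<in> (schwartz_families :: (real ^ 'm \<Rightarrow> (real ^ 'n \<Rightarrow> real) \<Rightarrow> real) set).
      \<forall>a \<in> tempered_distributions.
        summable_wrt v a \<and>
        (\<lambda>\<phi>\<in>schwartz_space. a (generated_operator v \<phi>)) \<in> tempered_distributions) \<and>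
   (\<forall>v \<in> (schwartz_families :: (real ^ 'm \<Rightarrow> (real ^ 'n \<Rightarrow> complex) \<Rightarrow> complex) set).
      \<forall>a \<in> tempered_distributions.
        summable_wrt v a \<and>
        (\<lambda>\<phi>\<in>schwartz_space. a (generated_operator v \<phi>)) \<in> tempered_distributions)"
  by (simp add: superposition_tempered schwartz_family_summable)

end
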